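(* Let $T$ be a single pure contraction on a Hilbert space $\mathcal{H}$ with $\Delta_T=1$. (a) If $\mathcal{H}$ is infinite dimensional and $m\in H^\infty(\mathbb{D})$ is a non-zero function such that $m(T)=0$, then $m$ is not a polynomial. (b) If $\mathcal{H}$ is finite dimensional, then the degree of the minimal polynomial of $T$ is $\dim\mathcal{H}$.
   Context: A contraction $T$ on $\mathcal{H}$ (i.e. $TT^*\le I$) is called pure if $T^nT^{*n}\to0$ in the strong operator topology as $n\to\infty$. $\Delta_T:=\dim\overline{\mathrm{ran}}(I-TT^* )$ is the (first) defect index of $T$. $H^\infty(\mathbb{D})$ is the multiplier algebra of the Hardy space $H^2(\mathbb{D})$ on the unit disc, and $m(T)$ is defined by the $H^\infty$ functional calculus (Sz.-Nagy–Foias) of the contraction $T$. *)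

theory Defs
  imports
    "HOL-Complex_Analysis.Complex_Analysis"
    "HOL-Library.Extended_Nat"
    "HOL-Computational_Algebra.Polynomial"
begin

class complex_vector = ab_group_add +
  fixes scaleC :: "complex \<Rightarrow> 'a \<Rightarrow> 'a" (infixr "*\<^sub>C" 75)
  assumes scaleC_add_right: "a *\<^sub>C (x + y) = a *\<^sub>C x + a *\<^sub>C y"
    and scaleC_add_left: "(a + b) *\<^sub>C x = a *\<^sub>C x + b *\<^sub>C x"
    and scaleC_scaleC: "a *\<^sub>C b *\<^sub>C x = (a * b) *\<^sub>C x"
    and scaleC_one: "1 *\<^sub>C x = x"

global_interpretation complex_vector:
  vector_space "scaleC :: complex \<Rightarrow> 'a \<Rightarrow> 'a::complex_vector"
  defines cspan = complex_vector.span
    and cdim = complex_vector.dim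
  by unfold_locales
    (simp_all add: scaleC_add_right scaleC_add_left scaleC_scaleC scaleC_one)

text \<open>The inner product is linear in its first argument. Completeness comes from
  \<^class>\<open>banach\<close>.\<close>

class complex_hilbert_space = banach + complex_vector +
  fixes cinner :: "'a \<Rightarrow> 'a \<Rightarrow> complex"
  assumes scaleR_scaleC: "r *\<^sub>R x = complex_of_real r *\<^sub>C x"
    and cinner_commute: "cinner x y = cnj (cinner y x)"
    and cinner_add_left: "cinner (x + y) z = cinner x z + cinner y z"
    and cinner_scaleC_left: "cinner (a *\<^sub>C x) y = a * cinner x y"
    and cinner_ge_zero: "0 \<le> Re (cinner x x)"
    and cinner_eq_zero_iff: "cinner x x = 0 \<longleftrightarrow> x = 0"
    and norm_eq_sqrt_cinner: "norm x = sqrt (Re (cinner x x))"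

text \<open>The constant \<^const>\<open>cdim\<close> is 0 on sets of infinite dimension, hence this variant.
  All infinite cardinals are identified.\<close>

definition cdimension :: "'a::complex_vector set \<Rightarrow> enat" where
  "cdimension S = (if \<exists>B. finite B \<and> S \<subseteq> cspan B then enat (cdim S) else \<infinity>)"

definition bounded_operator :: "('a::complex_hilbert_space \<Rightarrow> 'a) \<Rightarrow> bool" where
  "bounded_operator T \<longleftrightarrow> bounded_linear T \<and> (\<forall>c x. T (c *\<^sub>C x) = c *\<^sub>C T x)"

definition adjoint_op :: "('a::complex_hilbert_space \<Rightarrow> 'a) \<Rightarrow> 'a \<Rightarrow> 'a" where
  "adjoint_op T = (THE S. \<forall>x y. cinner (T x) y = cinner x (S y))"

definition positive_op :: "('a::complex_hilbert_space \<Rightarrow> 'a) \<Rightarrow> bool" where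
  "positive_op A \<longleftrightarrow> (\<forall>x. cinner (A x) x \<in> \<real>\<^sub>\<ge>\<^sub>0)"

definition contraction :: "('a::complex_hilbert_space \<Rightarrow> 'a) \<Rightarrow> bool" where
  "contraction T \<longleftrightarrow> bounded_operator T \<and> positive_op (\<lambda>x. x - T (adjoint_op T x))"

definition pure_contraction :: "('a::complex_hilbert_space \<Rightarrow> 'a) \<Rightarrow> bool" where
  "pure_contraction T \<longleftrightarrow> contraction T \<and>
     (\<forall>x. (\<lambda>n. (T ^^ n) ((adjoint_op T ^^ n) x)) \<longlonglongrightarrow> 0)"

definition defect_index :: "('a::complex_hilbert_space \<Rightarrow> 'a) \<Rightarrow> enat" where
  "defect_index T = cdimension (closure (range (\<lambda>x. x - T (adjoint_op T x))))"

definition taylor_coeff :: "(complex \<Rightarrow> complex) \<Rightarrow> nat \<Rightarrow> complex" where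
  "taylor_coeff f n = (deriv ^^ n) f 0 / fact n"

text \<open>Functions on the unit disc are represented by functions on the whole plane whose values
  outside the disc are irrelevant.\<close>

definition Hardy2 :: "(complex \<Rightarrow> complex) set" where
  "Hardy2 = {f. f holomorphic_on ball 0 1 \<and> summable (\<lambda>n. (cmod (taylor_coeff f n))\<^sup>2)}"

definition H_infinity :: "(complex \<Rightarrow> complex) set" where
  "H_infinity = {m. \<forall>f\<in>Hardy2. (\<lambda>z. m z * f z) \<in> Hardy2}"

text \<open>The Sz.-Nagy--Foias calculus: \<open>m(T)\<close> is the limit of \<open>m(rT)\<close> in the strong operator
  topology as \<open>r\<close> increases to 1, where \<open>m(rT)\<close> is given by the (norm convergent) power series.
  The limit exists for every \<open>m\<close> in \<^const>\<open>H_infinity\<close> when \<open>T\<close> is a completely non-unitary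
  contraction, in particular when \<open>T\<close> is a pure one.\<close>

definition H_infinity_calculus ::
    "(complex \<Rightarrow> complex) \<Rightarrow> ('a::complex_hilbert_space \<Rightarrow> 'a) \<Rightarrow> 'a \<Rightarrow> 'a" where
  "H_infinity_calculus m T x =
     Lim (at_left (1::real))
       (\<lambda>r. \<Sum>n. (taylor_coeff m n * complex_of_real r ^ n) *\<^sub>C (T ^^ n) x)"

definition poly_op :: "complex poly \<Rightarrow> ('a::complex_vector \<Rightarrow> 'a) \<Rightarrow> 'a \<Rightarrow> 'a" where
  "poly_op p T x = (\<Sum>i\<le>degree p. coeff p i *\<^sub>C (T ^^ i) x)"

definition minimal_polynomial :: "('a::complex_vector \<Rightarrow> 'a) \<Rightarrow> complex poly" where
  "minimal_polynomial T = (THE p. lead_coeff p = 1 \<and> poly_op p T = (\<lambda>x. 0) \<and>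
     (\<forall>q. lead_coeff q = 1 \<and> poly_op q T = (\<lambda>x. 0) \<longrightarrow> degree p \<le> degree q))"

end

theory Submission imports Defs begin

text \<open>Put \<open>D = I - T T*\<close>. Telescoping gives
  \<open>x - T\<^sup>n T*\<^sup>n x = (\<Sum>k<n. T\<^sup>k D T*\<^sup>k x)\<close>, and \<open>D\<close> has one-dimensional range, spanned by some
  vector \<open>v\<close>; so purity makes \<open>v\<close> cyclic for \<open>T\<close>. A non-zero polynomial \<open>p\<close> with \<open>p(T) v = 0\<close>
  confines the orbit of \<open>v\<close> to the span of its first \<open>deg p\<close> members, which is closed and hence
  everything. Therefore \<open>dim H \<le> deg p\<close>, which proves (a) and one half of (b). Conversely, a linear
  dependence among \<open>v, T v, \<dots>, T\<^sup>n v\<close> with \<open>n = dim H\<close> yields a monic polynomial that kills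
  \<open>v\<close> and hence the whole space.\<close>

section \<open>Complex scalars, linearity and closedness of finite spans\<close>

lemma norm_scaleC: "norm (a *\<^sub>C x) = cmod a * norm (x::'a::complex_hilbert_space)"
proof -
  have r: "cinner x (a *\<^sub>C y) = cnj a * cinner x y" for x y :: 'a
    by (metis cinner_commute cinner_scaleC_left complex_cnj_mult)
  have "cinner (a *\<^sub>C x) (a *\<^sub>C x) = of_real ((cmod a)\<^sup>2) * cinner x x"
    by (simp add: r cinner_scaleC_left complex_norm_square mult.assoc del: of_real_power)
  then have "Re (cinner (a *\<^sub>C x) (a *\<^sub>C x)) = (cmod a)\<^sup>2 * Re (cinner x x)"
    by (simp del: of_real_power)
  then show ?thesis
    by (simp add: norm_eq_sqrt_cinner real_sqrt_mult)
qed

text \<open>Boundedness with constant 1 over the reals makes the limit rule for products available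
  for complex scalars that vary along a filter.\<close>

lemma bounded_bilinear_scaleC:
  "bounded_bilinear ((*\<^sub>C) :: complex \<Rightarrow> 'a \<Rightarrow> 'a::complex_hilbert_space)"
proof
  show "\<exists>K. \<forall>a (b::'a). norm (a *\<^sub>C b) \<le> norm a * norm b * K"
    by (rule exI[of _ 1]) (simp add: norm_scaleC)
qed (simp_all add: scaleC_add_left scaleC_add_right scaleR_scaleC scaleC_scaleC mult.commute scaleR_conv_of_real)

lemma linear_funpow:
  assumes "Vector_Spaces.linear scaleC scaleC (T :: 'a::complex_vector \<Rightarrow> 'a)"
  shows "Vector_Spaces.linear scaleC scaleC (T ^^ n)"
proof (induction n)
  case 0
  show ?case
    using complex_vector.linear_id by (simp add: id_def)
next
  case (Suc n)
  then show ?case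
    unfolding funpow.simps by (rule Vector_Spaces.linear_compose[OF _ assms])
qed

lemma bounded_operator_linear:
  assumes "bounded_operator T"
  shows "Vector_Spaces.linear scaleC scaleC T"
proof -
  have "linear T" and "\<And>c x. T (c *\<^sub>C x) = c *\<^sub>C T x"
    using assms by (simp_all add: bounded_operator_def bounded_linear.linear)
  then show ?thesis
    unfolding Vector_Spaces.linear_iff
    by (simp add: complex_vector.vector_space_axioms linear_add)
qed

text \<open>A vector \<open>b\<close> outside the closed subspace \<open>cspan B\<close> has
  positive distance \<open>d\<close> from it. On the enlarged span the coefficient of
  \<open>b\<close> is then a functional of norm at most \<open>1 / d\<close>, so the coefficients of
  a convergent sequence converge too.\<close>

lemma closed_cspan_finite:
  fixes B :: "'a::complex_hilbert_space set"
  assumes "finite B"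
  shows "closed (cspan B)"
  using assms
proof (induction B)
  case empty
  show ?case by simp
next
  case (insert b B)
  interpret bounded_bilinear "(*\<^sub>C) :: complex \<Rightarrow> 'a \<Rightarrow> 'a"
    by (rule bounded_bilinear_scaleC)
  show ?case
  proof (cases "b \<in> cspan B")
    case True
    then show ?thesis
      using insert.IH by (simp add: complex_vector.span_redundant)
  next
    case False
    have ne: "cspan B \<noteq> {}"
      using complex_vector.span_zero by blast
    define d where "d = infdist b (cspan B)"
    have d: "d > 0"
      unfolding d_def by (rule infdist_pos_not_in_closed) (use insert.IH ne False in auto)
    have dist: "cmod c * d \<le> norm (y + c *\<^sub>C b)" if "y \<in> cspan B" for c y
    proof (cases "c = 0")
      case False
      \<comment> \<open>Up to the factor \<open>c\<close>, the vector to be estimated is the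
        difference of \<open>b\<close> and this member of the subspace.\<close>
      have "- (inverse c *\<^sub>C y) \<in> cspan B"
        using that complex_vector.span_neg complex_vector.span_scale by blast
      then have "d \<le> dist b (- (inverse c *\<^sub>C y))"
        unfolding d_def by (rule infdist_le)
      then have "cmod c * d \<le> norm (c *\<^sub>C (b + inverse c *\<^sub>C y))"
        by (simp add: dist_norm norm_scaleC mult_left_mono)
      also have "c *\<^sub>C (b + inverse c *\<^sub>C y) = y + c *\<^sub>C b"
        using False by (simp add: scaleC_add_right scaleC_scaleC scaleC_one)
      finally show ?thesis .
    qed simp
    show ?thesis
      unfolding closed_sequential_limits
    proof (intro allI impI, elim conjE)
      fix f l assume f: "\<forall>n. f n \<in> cspan (insert b B)" and l: "f \<longlonglongrightarrow> l"
      obtain c where c: "\<And>n. f n - c n *\<^sub>C b \<in> cspan B"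
        using f unfolding complex_vector.span_breakdown_eq by metis
      have diff: "cmod (c m - c n) * d \<le> norm (f m - f n)" for m n
        using dist[OF complex_vector.span_diff[OF c[of m] c[of n]], of "c m - c n"]
        by (simp add: diff_left algebra_simps)
      have "Cauchy c"
      proof (rule metric_CauchyI)
        fix e :: real assume "e > 0"
        then obtain M where M: "\<And>m n. m \<ge> M \<Longrightarrow> n \<ge> M \<Longrightarrow> dist (f m) (f n) < e * d"
          using metric_CauchyD[OF LIMSEQ_imp_Cauchy[OF l], of "e * d"] d by auto
        have "dist (c m) (c n) < e" if "m \<ge> M" "n \<ge> M" for m n
        proof -
          have "cmod (c m - c n) * d < e * d"
            using diff[of m n] M[OF that] by (simp add: dist_norm)
          then show ?thesis using d by (simp add: dist_norm)
        qed
        then show "\<exists>M. \<forall>m\<ge>M. \<forall>n\<ge>M. dist (c m) (c n) < e" by blast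
      qed
      then obtain a where a: "c \<longlonglongrightarrow> a"
        by (auto simp: Cauchy_convergent_iff convergent_def)
      have "(\<lambda>n. f n - c n *\<^sub>C b) \<longlonglongrightarrow> l - a *\<^sub>C b"
        by (intro tendsto_diff l tendsto a tendsto_const)
      then have "l - a *\<^sub>C b \<in> cspan B"
        by (rule closed_sequentially[OF insert.IH c])
      then show "l \<in> cspan (insert b B)"
        unfolding complex_vector.span_breakdown_eq by blast
    qed
  qed
qed

section \<open>Polynomials in an operator and orbits\<close>

lemma poly_op_eq_sum:
  assumes "degree p \<le> N"
  shows "poly_op p T x = (\<Sum>i\<le>N. coeff p i *\<^sub>C (T ^^ i) x)"
proof -
  have "coeff p i *\<^sub>C (T ^^ i) x = 0" if "i \<in> {..N} - {..degree p}" for i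
    using that by (simp add: coeff_eq_0)
  then show ?thesis
    unfolding poly_op_def using assms by (intro sum.mono_neutral_left) auto
qed

lemma poly_op_diff: "poly_op (p - q) T x = poly_op p T x - poly_op q T x"
proof -
  let ?N = "max (degree p) (degree q)"
  have "poly_op (p - q) T x = (\<Sum>i\<le>?N. coeff (p - q) i *\<^sub>C (T ^^ i) x)"
    by (rule poly_op_eq_sum) (simp add: degree_diff_le_max)
  then show ?thesis
    by (simp add: poly_op_eq_sum[of p ?N] poly_op_eq_sum[of q ?N] sum_subtractf
        complex_vector.scale_left_diff_distrib)
qed

lemma linear_poly_op:
  assumes "Vector_Spaces.linear scaleC scaleC T"
  shows "Vector_Spaces.linear scaleC scaleC (poly_op p T)"
proof -
  interpret P: Vector_Spaces.linear scaleC scaleC "T ^^ i" for i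
    by (rule linear_funpow[OF assms])
  show ?thesis
    unfolding Vector_Spaces.linear_iff poly_op_def
    by (auto simp: P.add P.scale scaleC_add_right sum.distrib complex_vector.scale_sum_right
        scaleC_scaleC mult.commute complex_vector.vector_space_axioms)
qed

lemma poly_op_funpow:
  assumes "Vector_Spaces.linear scaleC scaleC T"
  shows "poly_op p T ((T ^^ k) x) = (T ^^ k) (poly_op p T x)"
proof -
  interpret P: Vector_Spaces.linear scaleC scaleC "T ^^ k"
    by (rule linear_funpow[OF assms])
  show ?thesis
    unfolding poly_op_def P.sum P.scale
    by (metis add.commute comp_apply funpow_add)
qed

text \<open>Applying \<open>T ^^ j\<close> to the relation \<open>poly_op p T v = 0\<close> and
  dividing by the leading coefficient expresses each late orbit member through earlier ones. The
  induction is strong because the relation reaches back up to \<open>degree p\<close>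
  places.\<close>

lemma orbit_subset_cspan:
  assumes T: "Vector_Spaces.linear scaleC scaleC T"
    and p: "p \<noteq> 0" "poly_op p T v = 0"
  shows "range (\<lambda>k. (T ^^ k) v) \<subseteq> cspan ((\<lambda>k. (T ^^ k) v) ` {..<degree p})"
    (is "_ \<subseteq> cspan ?W")
proof -
  have "(T ^^ k) v \<in> cspan ?W" for k
  proof (induction k rule: less_induct)
    case (less k)
    show ?case
    proof (cases "k < degree p")
      case True
      then show ?thesis
        by (intro complex_vector.span_base) blast
    next
      case False
      define j where "j = k - degree p"
      have k: "k = degree p + j"
        using False by (simp add: j_def)
      interpret P: Vector_Spaces.linear scaleC scaleC "T ^^ j"
        by (rule linear_funpow[OF T])
      have "0 = poly_op p T ((T ^^ j) v)"
        by (simp add: poly_op_funpow[OF T] p P.zero)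
      also have "\<dots> = (\<Sum>i<degree p. coeff p i *\<^sub>C (T ^^ (i + j)) v) + lead_coeff p *\<^sub>C (T ^^ k) v"
        by (simp add: poly_op_def lessThan_Suc_atMost[symmetric] funpow_add k)
      finally have eq: "lead_coeff p *\<^sub>C (T ^^ k) v = - (\<Sum>i<degree p. coeff p i *\<^sub>C (T ^^ (i + j)) v)"
        by (simp add: eq_neg_iff_add_eq_0 add.commute)
      have "lead_coeff p *\<^sub>C (T ^^ k) v \<in> cspan ?W"
        unfolding eq
        by (intro complex_vector.span_neg complex_vector.span_sum complex_vector.span_scale less)
          (simp add: k)
      then have "inverse (lead_coeff p) *\<^sub>C lead_coeff p *\<^sub>C (T ^^ k) v \<in> cspan ?W"
        by (rule complex_vector.span_scale)
      then show ?thesis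
        using p by (simp add: scaleC_scaleC scaleC_one)
    qed
  qed
  then show ?thesis by blast
qed

section \<open>Linear dependence and annihilating polynomials\<close>

lemma cspan_image_lessThan_eq_sum:
  assumes "x \<in> cspan (f ` {..<n::nat})"
  shows "\<exists>c. x = (\<Sum>i<n. c i *\<^sub>C f i)"
  using assms
proof (induction n arbitrary: x)
  case (Suc n)
  obtain a where "x - a *\<^sub>C f n \<in> cspan (f ` {..<n})"
    using Suc.prems by (auto simp: lessThan_Suc complex_vector.span_breakdown_eq)
  from Suc.IH[OF this] obtain c where "x - a *\<^sub>C f n = (\<Sum>i<n. c i *\<^sub>C f i)"
    by blast
  \<comment> \<open>Coefficients belong to indices rather than vectors, so repeated values of
    \<open>f\<close> cause no clash.\<close>
  then have "x = (\<Sum>i<Suc n. (c(n := a)) i *\<^sub>C f i)"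
    by (simp add: algebra_simps)
  then show ?case by blast
qed simp

text \<open>A vector outside the span of its predecessors also differs from each of them, so the
  cardinality grows along with the independent set.\<close>

lemma independent_if_notin_span_prefix:
  assumes "\<And>j. j < n \<Longrightarrow> f j \<notin> cspan (f ` {..<j})"
  shows "complex_vector.independent (f ` {..<n::nat}) \<and> card (f ` {..<n}) = n"
  using assms
proof (induction n)
  case (Suc n)
  then have span: "f n \<notin> cspan (f ` {..<n})" by blast
  then have "f n \<notin> f ` {..<n}"
    by (metis complex_vector.span_base)
  moreover have "complex_vector.independent (f ` {..<n}) \<and> card (f ` {..<n}) = n"
    using Suc by simp
  ultimately show ?case
    using span by (simp add: lessThan_Suc complex_vector.independent_insertI)
qed (simp add: complex_vector.independent_empty)

text \<open>The dependence is sought in the form that one orbit member lies in the span of its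
  predecessors; the resulting polynomial is then monic without any division.\<close>

lemma ex_monic_poly_op_eq_0:
  fixes v :: "'a::complex_vector"
  assumes "finite B" "cspan B = (UNIV :: 'a set)"
  shows "\<exists>p. lead_coeff p = 1 \<and> degree p \<le> cdim (UNIV :: 'a set) \<and> poly_op p T v = 0"
proof -
  let ?f = "\<lambda>k. (T ^^ k) v"
  let ?n = "cdim (UNIV :: 'a set)"
  have "\<exists>m\<le>?n. ?f m \<in> cspan (?f ` {..<m})"
  proof (rule ccontr)
    assume "\<not> ?thesis"
    then have *: "complex_vector.independent (?f ` {..<Suc ?n}) \<and> card (?f ` {..<Suc ?n}) = Suc ?n"
      by (intro independent_if_notin_span_prefix) auto
    obtain A :: "'a set" where A: "complex_vector.independent A" "UNIV \<subseteq> cspan A" "card A = ?n"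
      using complex_vector.basis_exists[of UNIV] by metis
    \<comment> \<open>\<open>card\<close> is 0 on infinite sets, so the cardinality of the basis
      \<open>A\<close> does not give its finiteness; the finite spanning set \<open>B\<close>
      does.\<close>
    have "finite A"
      using complex_vector.independent_span_bound[OF assms(1) A(1)] assms(2) by simp
    then have "card (?f ` {..<Suc ?n}) \<le> card A"
      using complex_vector.independent_span_bound[of A "?f ` {..<Suc ?n}"] * A(2) by blast
    with * A(3) show False by simp
  qed
  then obtain m c where m: "m \<le> ?n" and c: "?f m = (\<Sum>i<m. c i *\<^sub>C ?f i)"
    using cspan_image_lessThan_eq_sum by blast
  define p where "p = monom 1 m - (\<Sum>i<m. monom (c i) i)"
  have coeff: "coeff p i = (if i = m then 1 else if i < m then - c i else 0)" for i
    by (auto simp: p_def coeff_sum)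
  have deg: "degree p = m"
    by (intro antisym degree_le le_degree) (auto simp: coeff)
  have "poly_op p T v = (\<Sum>i<m. - (c i *\<^sub>C ?f i)) + ?f m"
    by (simp add: poly_op_def deg lessThan_Suc_atMost[symmetric] coeff scaleC_one)
  then have "poly_op p T v = 0"
    by (simp add: c sum_negf)
  with m show ?thesis
    by (intro exI[of _ p]) (simp add: deg coeff)
qed

section \<open>The cyclic vector\<close>

lemma cdimension_eq_1_subset_cspan:
  assumes "cdimension S = 1"
  shows "\<exists>v. S \<subseteq> cspan {v}"
proof -
  from assms have "cdim S = 1"
    by (auto simp: cdimension_def one_enat_def split: if_splits)
  then obtain A where "S \<subseteq> cspan A" "card A = 1"
    using complex_vector.basis_exists[of S] by metis
  then show ?thesis
    by (metis card_1_singletonE)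
qed

lemma pure_contraction_cyclic:
  fixes T :: "'a::complex_hilbert_space \<Rightarrow> 'a"
  assumes "pure_contraction T" "defect_index T = 1"
  shows "\<exists>v. \<forall>x. x \<in> closure (cspan (range (\<lambda>k. (T ^^ k) v)))"
proof -
  define S where "S = adjoint_op T"
  have T: "Vector_Spaces.linear scaleC scaleC T"
    using assms bounded_operator_linear unfolding pure_contraction_def contraction_def by blast
  interpret P: Vector_Spaces.linear scaleC scaleC "T ^^ k" for k
    by (rule linear_funpow[OF T])
  obtain v where v: "closure (range (\<lambda>x. x - T (S x))) \<subseteq> cspan {v}"
    using cdimension_eq_1_subset_cspan assms(2) unfolding defect_index_def S_def by blast
  let ?K = "cspan (range (\<lambda>k. (T ^^ k) v))"
  have "x \<in> closure ?K" for x
  proof -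
    \<comment> \<open>The difference is \<open>T ^^ k\<close> applied to a value of the defect
      operator, hence a multiple of \<open>(T ^^ k) v\<close>.\<close>
    have "(T ^^ k) ((S ^^ k) x) - (T ^^ Suc k) ((S ^^ Suc k) x) \<in> ?K" for k
    proof -
      have "(S ^^ k) x - T (S ((S ^^ k) x)) \<in> cspan {v}"
        using v closure_subset by blast
      then obtain c where c: "(S ^^ k) x - T (S ((S ^^ k) x)) = c *\<^sub>C v"
        by (auto simp: complex_vector.span_singleton)
      have "(T ^^ k) ((S ^^ k) x) - (T ^^ Suc k) ((S ^^ Suc k) x)
          = (T ^^ k) ((S ^^ k) x - T (S ((S ^^ k) x)))"
        by (simp add: P.diff funpow_swap1)
      also have "\<dots> = c *\<^sub>C (T ^^ k) v"
        by (simp add: c P.scale)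
      finally show ?thesis
        by (simp add: complex_vector.span_scale complex_vector.span_base)
    qed
    then have "(\<Sum>k<n. (T ^^ k) ((S ^^ k) x) - (T ^^ Suc k) ((S ^^ Suc k) x)) \<in> ?K" for n
      by (intro complex_vector.span_sum)
    then have mem: "x - (T ^^ n) ((S ^^ n) x) \<in> ?K" for n
      by (subst (asm) sum_lessThan_telescope') simp
    have "(\<lambda>n. x - (T ^^ n) ((S ^^ n) x)) \<longlonglongrightarrow> x - 0"
      using assms(1) unfolding pure_contraction_def S_def by (intro tendsto_intros) blast
    then show ?thesis
      unfolding closure_sequential
      by (intro exI[of _ "\<lambda>n. x - (T ^^ n) ((S ^^ n) x)"]) (simp add: mem)
  qed
  then show ?thesis by blast
qed

section \<open>The functional calculus on polynomials\<close>

lemma taylor_coeff_poly: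
  assumes "\<And>z. z \<in> ball 0 1 \<Longrightarrow> m z = poly p z"
  shows "taylor_coeff m n = coeff p n"
proof -
  have "(deriv ^^ n) (poly p) = poly ((pderiv ^^ n) p)"
    by (induction n) (auto intro!: DERIV_imp_deriv)
  \<comment> \<open>Derivatives at 0 depend only on a neighbourhood of 0, so the values of
    \<open>m\<close> off the disc do not matter.\<close>
  moreover have "\<forall>\<^sub>F z in nhds 0. m z = poly p z"
    using eventually_nhds_in_open[of "ball 0 1" "0::complex"] assms
    by (auto elim: eventually_mono)
  then have "(deriv ^^ n) m 0 = (deriv ^^ n) (poly p) 0"
    by (intro higher_deriv_cong_ev) auto
  ultimately show ?thesis
    by (simp add: taylor_coeff_def poly_0_coeff_0 coeff_higher_pderiv pochhammer_fact[symmetric])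
qed

text \<open>Taylor coefficients beyond the degree vanish, so the series is a finite sum and the
  limit at 1 can be taken term by term.\<close>

lemma H_infinity_calculus_poly:
  assumes "\<And>z. z \<in> ball 0 1 \<Longrightarrow> m z = poly p z"
  shows "H_infinity_calculus m T x = poly_op p T x"
proof -
  interpret bounded_bilinear "(*\<^sub>C) :: complex \<Rightarrow> 'a \<Rightarrow> 'a"
    by (rule bounded_bilinear_scaleC)
  have coeff: "taylor_coeff m n = coeff p n" for n
    by (rule taylor_coeff_poly) (rule assms)
  have "(\<Sum>n. (taylor_coeff m n * complex_of_real r ^ n) *\<^sub>C (T ^^ n) x)
      = (\<Sum>n\<le>degree p. (coeff p n * complex_of_real r ^ n) *\<^sub>C (T ^^ n) x)" for r
    unfolding coeff
    by (rule suminf_finite) (auto simp: coeff_eq_0)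
  moreover have "((\<lambda>r. \<Sum>n\<le>degree p. (coeff p n * complex_of_real r ^ n) *\<^sub>C (T ^^ n) x)
      \<longlongrightarrow> (\<Sum>n\<le>degree p. (coeff p n * complex_of_real 1 ^ n) *\<^sub>C (T ^^ n) x)) (at_left 1)"
    by (intro tendsto_sum tendsto tendsto_intros)
  ultimately show ?thesis
    unfolding H_infinity_calculus_def poly_op_def
    by (intro tendsto_Lim) auto
qed

section \<open>Dimension of the space and degrees of annihilators\<close>

theorem theorem3p10:
  fixes T :: "'a::complex_hilbert_space \<Rightarrow> 'a"
  assumes "pure_contraction T"
    and "defect_index T = 1"
  shows "(cdimension (UNIV :: 'a set) = \<infinity> \<longrightarrow>
            (\<forall>m\<in>H_infinity. (\<exists>z\<in>ball 0 1. m z \<noteq> 0) \<and> H_infinity_calculus m T = (\<lambda>x. 0) \<longrightarrow>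
               \<not> (\<exists>p :: complex poly. \<forall>z\<in>ball 0 1. m z = poly p z)))
       \<and> (cdimension (UNIV :: 'a set) \<noteq> \<infinity> \<longrightarrow>
            enat (degree (minimal_polynomial T)) = cdimension (UNIV :: 'a set))"
proof -
  let ?n = "cdim (UNIV :: 'a set)"
  have T: "Vector_Spaces.linear scaleC scaleC T"
    using assms(1) bounded_operator_linear unfolding pure_contraction_def contraction_def by blast
  obtain v where v: "\<And>x. x \<in> closure (cspan (range (\<lambda>k. (T ^^ k) v)))"
    using pure_contraction_cyclic[OF assms] by blast
  \<comment> \<open>These facts are stated for any \<open>p\<close>, as they serve the polynomial
    form of \<open>m\<close>, the monic annihilator, its competitors and a difference of two
    candidates.\<close>
  have span: "cspan (range (\<lambda>k. (T ^^ k) v)) = UNIV"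
    and fin: "finite ((\<lambda>k. (T ^^ k) v) ` {..<degree p})"
      "cspan ((\<lambda>k. (T ^^ k) v) ` {..<degree p}) = UNIV"
    and dim: "?n \<le> degree p" if p: "p \<noteq> 0" "poly_op p T v = 0" for p
  proof -
    let ?W = "(\<lambda>k. (T ^^ k) v) ` {..<degree p}"
    show fin: "finite ?W" by simp
    have eq: "cspan (range (\<lambda>k. (T ^^ k) v)) = cspan ?W"
      using orbit_subset_cspan[OF T p]
      by (intro antisym complex_vector.span_minimal complex_vector.span_mono) auto
    \<comment> \<open>A finite span is closed, so the closure that contains every vector is the span
      itself.\<close>
    show "cspan (range (\<lambda>k. (T ^^ k) v)) = UNIV" and W: "cspan ?W = UNIV"
      using v unfolding eq closure_closed[OF closed_cspan_finite[OF fin]] by blast+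
    have "?n \<le> card ?W"
      using W fin by (intro complex_vector.dim_le_card) auto
    also have "\<dots> \<le> degree p"
      using card_image_le[of "{..<degree p}"] by simp
    finally show "?n \<le> degree p" .
  qed
  show ?thesis
  proof (intro conjI impI ballI notI)
    fix m
    assume inf: "cdimension (UNIV :: 'a set) = \<infinity>"
      and m: "(\<exists>z\<in>ball 0 1. m z \<noteq> 0) \<and> H_infinity_calculus m T = (\<lambda>x. 0)"
      and "\<exists>p :: complex poly. \<forall>z\<in>ball 0 1. m z = poly p z"
    then obtain p where p: "\<And>z. z \<in> ball 0 1 \<Longrightarrow> m z = poly p z"
      by blast
    \<comment> \<open>\<open>p\<close> is non-zero because \<open>m\<close> takes a non-zero value
      inside the disc, where the two agree.\<close>
    then have "p \<noteq> 0" "poly_op p T v = 0"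
      using m H_infinity_calculus_poly[of m p T v] by auto
    from fin[OF this] inf show False
      by (metis cdimension_def enat.distinct(1) subset_UNIV)
  next
    assume "cdimension (UNIV :: 'a set) \<noteq> \<infinity>"
    then obtain B :: "'a set" where B: "finite B" "cspan B = UNIV"
      and n: "cdimension (UNIV :: 'a set) = enat ?n"
      unfolding cdimension_def by (metis top.extremum_uniqueI)
    obtain p where p: "lead_coeff p = 1" "degree p \<le> ?n" "poly_op p T v = 0"
      using ex_monic_poly_op_eq_0[OF B] by blast
    have "p \<noteq> 0"
      using p(1) by auto
    then have deg: "degree p = ?n"
      using dim p by (intro antisym) auto
    interpret P: Vector_Spaces.linear scaleC scaleC "poly_op p T"
      by (rule linear_poly_op[OF T])
    interpret Tk: Vector_Spaces.linear scaleC scaleC "T ^^ k" for k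
      by (rule linear_funpow[OF T])
    \<comment> \<open>\<open>poly_op p T\<close> commutes with powers of \<open>T\<close>, so it
      kills the whole orbit of \<open>v\<close>, which spans the space.\<close>
    have "poly_op p T x = 0" for x
      by (rule P.eq_0_on_span[of "range (\<lambda>k. (T ^^ k) v)"])
        (auto simp: span[OF \<open>p \<noteq> 0\<close> p(3), unfolded cspan_def] poly_op_funpow[OF T] p(3) Tk.zero)
    then have p0: "poly_op p T = (\<lambda>x. 0)"
      by blast
    have min: "degree p \<le> degree q" if "lead_coeff q = 1" "poly_op q T = (\<lambda>x. 0)" for q
    proof -
      have "q \<noteq> 0"
        using that(1) by auto
      then show ?thesis
        using dim[of q] that(2) deg by simp
    qed
    have "minimal_polynomial T = p"
      unfolding minimal_polynomial_def
    proof (rule the_equality)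
      fix q
      assume "lead_coeff q = 1 \<and> poly_op q T = (\<lambda>x. 0) \<and>
        (\<forall>q'. lead_coeff q' = 1 \<and> poly_op q' T = (\<lambda>x. 0) \<longrightarrow> degree q \<le> degree q')"
      then have q: "lead_coeff q = 1" "poly_op q T = (\<lambda>x. 0)" "degree q = degree p"
        using p(1) p0 min by (auto intro: antisym)
      \<comment> \<open>This uniqueness is what \<open>THE\<close> requires. A non-zero
        \<open>q - p\<close> would annihilate \<open>v\<close> and so have degree at least
        \<open>?n\<close>, but the leading terms of two monic polynomials of degree
        \<open>?n\<close> cancel.\<close>
      show "q = p"
      proof (rule ccontr)
        assume "q \<noteq> p"
        then have nz: "q - p \<noteq> 0" by simp
        have "poly_op (q - p) T v = 0"
          by (simp add: poly_op_diff q(2) p(3))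
        then have "?n \<le> degree (q - p)"
          using dim nz by blast
        then have "degree (q - p) = ?n"
          using degree_diff_le_max[of q p] q(3) deg by simp
        then have "lead_coeff (q - p) = lead_coeff q - lead_coeff p"
          using q(3) deg by simp
        then have "lead_coeff (q - p) = 0"
          unfolding q(1) p(1) by simp
        with nz show False
          unfolding leading_coeff_0_iff by blast
      qed
    qed (use p(1) p0 min in auto)
    then show "enat (degree (minimal_polynomial T)) = cdimension (UNIV :: 'a set)"
      using deg n by simp
  qed
qed

end
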